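(* Let $n\ge 4$ and let $U_n$ be any connected unicyclic graph on $n$ vertices. Then \[ RRR(U_n)\ \ge\ \begin{cases} 1+2\sqrt{n-2}, & 4\le n\le 16,\\[2pt] 1+3\sqrt{2}+\sqrt{n-5}, & n\ge 17.\end{cases} \] For $4\le n\le 16$, equality holds if and only if $U_n\cong S_n^{+}$; for $n\ge 17$, equality holds if and only if $U_n\cong H_n$.
   Context: All graphs are simple, finite, undirected and connected; $d_u$ denotes the degree of vertex $u$. A connected graph on $n$ vertices is unicyclic if it has exactly $n$ edges. The reduced reciprocal Randić index of a graph $G$ is \[ RRR(G)=\sum_{uv\in E(G)}\sqrt{(d_u-1)(d_v-1)}. \] $S_n^{+}$ denotes the unicyclic graph obtained from the star $K_{1,n-1}$ by adding an edge between two of its pendent (degree-one) vertices (so $RRR(S_n^+)=1+2\sqrt{n-2}$). For $n\ge 6$, $H_n$ denotes the $n$-vertex unicyclic graph consisting of a triangle on vertices $y,a,b$, a vertex $w$ adjacent to $y$, a vertex $v$ adjacent to $w$, and $n-5$ pendent vertices all adjacent to $v$ (so $d_y=3$, $d_a=d_b=d_w=2$, $d_v=n-4$, and $RRR(H_n)=1+3\sqrt{2}+\sqrt{n-5}$). *)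

theory Defs
  imports Complex_Main
begin

definition simple_graph :: "'a set \<Rightarrow> 'a set set \<Rightarrow> bool" where
  "simple_graph V E \<longleftrightarrow> finite V \<and> (\<forall>e\<in>E. \<exists>u v. u \<noteq> v \<and> u \<in> V \<and> v \<in> V \<and> e = {u, v})"

definition adj :: "'a set set \<Rightarrow> 'a \<Rightarrow> 'a \<Rightarrow> bool" where
  "adj E u v \<longleftrightarrow> {u, v} \<in> E"

definition connected_graph :: "'a set \<Rightarrow> 'a set set \<Rightarrow> bool" where
  "connected_graph V E \<longleftrightarrow> V \<noteq> {} \<and> (\<forall>u\<in>V. \<forall>v\<in>V. (adj E)\<^sup>*\<^sup>* u v)"

definition unicyclic :: "'a set \<Rightarrow> 'a set set \<Rightarrow> bool" where
  "unicyclic V E \<longleftrightarrow> simple_graph V E \<and> connected_graph V E \<and> card E = card V"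

definition degree :: "'a set set \<Rightarrow> 'a \<Rightarrow> nat" where
  "degree E u = card {e \<in> E. u \<in> e}"

definition RRR :: "'a set set \<Rightarrow> real" where
  "RRR E = (\<Sum>e\<in>E. sqrt (\<Prod>x\<in>e. real (degree E x) - 1))"

definition graph_iso :: "'a set \<Rightarrow> 'a set set \<Rightarrow> 'b set \<Rightarrow> 'b set set \<Rightarrow> bool" where
  "graph_iso V1 E1 V2 E2 \<longleftrightarrow>
     (\<exists>f. bij_betw f V1 V2 \<and> (\<forall>u\<in>V1. \<forall>v\<in>V1. {u, v} \<in> E1 \<longleftrightarrow> {f u, f v} \<in> E2))"

definition Splus_V :: "nat \<Rightarrow> nat set" where
  "Splus_V n = {0..<n}"

definition Splus_E :: "nat \<Rightarrow> nat set set" where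
  "Splus_E n = {{0, k} | k. k \<in> {1..<n}} \<union> {{1, 2}}"

definition H_V :: "nat \<Rightarrow> nat set" where
  "H_V n = {0..<n}"

definition H_E :: "nat \<Rightarrow> nat set set" where
  "H_E n = {{0, 1}, {0, 2}, {1, 2}, {0, 3}, {3, 4}} \<union> {{4, k} | k. k \<in> {5..<n}}"

end

theory Submission
  imports Defs
begin

text \<open>
  Put \<open>x v = d v - 1\<close>. Leaves contribute nothing, so RRR is the sum of \<open>sqrt (x u * x v)\<close> over the
  edges of the core, the subgraph induced by the \<open>m\<close> vertices of degree at least 2. The core again
  has as many edges as vertices, and the values \<open>x v \<ge> 1\<close> on it sum to \<open>n\<close>. This sum is concave
  in \<open>x\<close>, so it is bounded below by its values at the extreme points, where all the excess over the
  lower bounds sits on one vertex.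

  If every core vertex has core degree at least 2, the lower bounds \<open>x \<ge> 1\<close> give
  \<open>m - 2 + 2 * sqrt (1 + n - m)\<close>, which is smallest for \<open>m = 3\<close>. Otherwise the core has a leaf,
  hence a vertex \<open>y\<close> of core degree at least 3, where \<open>x y \<ge> 2\<close>; the three edges at \<open>y\<close> then cost
  \<open>sqrt 2\<close> each, and the bound is \<open>m - 4 + 3 * sqrt 2 + sqrt (n - m)\<close>, smallest for \<open>m = 5\<close>.
  For \<open>m = 4\<close> all core vertices are adjacent to \<open>y\<close>, and one gets the larger value
  \<open>1 + 2 * sqrt 2 + sqrt 2 * sqrt (n - 4)\<close>.
\<close>

section \<open>Simple graphs\<close>

lemma simple_graph_edgeE:
  assumes "simple_graph V E" "e \<in> E"
  obtains u v where "u \<noteq> v" "u \<in> V" "v \<in> V" "e = {u, v}"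
  using assms unfolding simple_graph_def by blast

lemma simple_graph_finite:
  assumes "simple_graph V E"
  shows "finite V" "finite E" "E \<subseteq> Pow V"
proof -
  show V: "finite V" using assms by (simp add: simple_graph_def)
  show P: "E \<subseteq> Pow V" using assms by (fastforce simp: simple_graph_def)
  show "finite E" using V P by (meson finite_Pow_iff finite_subset)
qed

lemma simple_graph_edge_card: "simple_graph V E \<Longrightarrow> e \<in> E \<Longrightarrow> card e = 2"
  by (erule (1) simple_graph_edgeE) auto

lemma simple_graph_edgeD:
  assumes "simple_graph V E" "{u, v} \<in> E"
  shows "u \<noteq> v" "u \<in> V" "v \<in> V"
  using simple_graph_edge_card[OF assms] simple_graph_finite(3)[OF assms(1)] assms(2)
  by (auto simp: card_insert_if split: if_splits)

lemma simple_graph_mono: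
  assumes "simple_graph V E" "E' \<subseteq> E" "V' \<subseteq> V" "\<And>e. e \<in> E' \<Longrightarrow> e \<subseteq> V'"
  shows "simple_graph V' E'"
  unfolding simple_graph_def
proof (intro conjI ballI)
  show "finite V'" using assms simple_graph_finite(1) finite_subset by blast
  fix e assume e: "e \<in> E'"
  then obtain u v where "u \<noteq> v" "e = {u, v}"
    using assms(1,2) by (meson simple_graph_edgeE subsetD)
  with assms(4)[OF e] show "\<exists>u v. u \<noteq> v \<and> u \<in> V' \<and> v \<in> V' \<and> e = {u, v}" by blast
qed

lemma incident_edges_eq_image:
  assumes "simple_graph V E"
  shows "{e \<in> E. u \<in> e} = (\<lambda>w. {u, w}) ` {w. {u, w} \<in> E}"
proof (intro equalityI subsetI)
  fix e assume "e \<in> {e \<in> E. u \<in> e}"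
  then have e: "e \<in> E" "u \<in> e" by auto
  from assms e(1) obtain a b where "e = {a, b}" by (rule simple_graph_edgeE)
  with e show "e \<in> (\<lambda>w. {u, w}) ` {w. {u, w} \<in> E}" by (auto simp: insert_commute)
qed auto

lemma inj_on_doubleton: "inj_on (\<lambda>w. {u, w}) A"
  by (auto simp: inj_on_def doubleton_eq_iff)

lemma degree_eq_card_neighbours:
  assumes "simple_graph V E"
  shows "degree E u = card {w. {u, w} \<in> E}"
  unfolding degree_def incident_edges_eq_image[OF assms]
  by (rule card_image[OF inj_on_doubleton])

lemma finite_neighbours:
  assumes "simple_graph V E"
  shows "finite {w. {u, w} \<in> E}" "{w. {u, w} \<in> E} \<subseteq> V - {u}"
proof -
  show "{w. {u, w} \<in> E} \<subseteq> V - {u}" using simple_graph_edgeD[OF assms] by blast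
  then show "finite {w. {u, w} \<in> E}"
    using simple_graph_finite(1)[OF assms] by (meson finite_Diff finite_subset)
qed

text \<open>Double counting of incident pairs: \<open>v\<close> is an end of
  \<open>degree E v\<close> edges. Besides the handshake identity (\<open>g = 1\<close>), this
  totals the chord terms in the concavity bounds and counts the leaves in
  \<open>core_card\<close>.\<close>

lemma sum_edges_sum_vertices:
  fixes g :: "'a \<Rightarrow> real"
  assumes "simple_graph V E"
  shows "(\<Sum>e\<in>E. \<Sum>v\<in>e. g v) = (\<Sum>v\<in>V. real (degree E v) * g v)"
proof -
  note fin = simple_graph_finite[OF assms]
  have "(\<Sum>e\<in>E. \<Sum>v\<in>e. g v) = (\<Sum>e\<in>E. \<Sum>v\<in>V. if v \<in> e then g v else 0)"
  proof (rule sum.cong[OF refl])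
    fix e assume "e \<in> E"
    then have "{v \<in> V. v \<in> e} = e" using fin(3) by blast
    then show "(\<Sum>v\<in>e. g v) = (\<Sum>v\<in>V. if v \<in> e then g v else 0)"
      by (simp add: sum.inter_filter[OF fin(1), symmetric])
  qed
  also have "\<dots> = (\<Sum>v\<in>V. \<Sum>e\<in>E. if v \<in> e then g v else 0)" by (rule sum.swap)
  also have "\<dots> = (\<Sum>v\<in>V. real (degree E v) * g v)"
    by (simp add: sum.inter_filter[OF fin(2), symmetric] degree_def)
  finally show ?thesis .
qed

lemma handshake:
  assumes "simple_graph V E"
  shows "(\<Sum>v\<in>V. degree E v) = 2 * card E"
proof -
  have "real (\<Sum>v\<in>V. degree E v) = (\<Sum>e\<in>E. \<Sum>v\<in>e. 1)"
    using sum_edges_sum_vertices[OF assms, of "\<lambda>_. 1"] by simp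
  also have "\<dots> = (\<Sum>e\<in>E. 2)"
    by (intro sum.cong) (use simple_graph_edge_card[OF assms] in auto)
  finally show ?thesis by (simp del: of_nat_sum flip: of_nat_mult)
qed

section \<open>Isomorphism and the two extremal graphs\<close>

text \<open>Serves to number the vertices so that chosen ones receive the fixed labels 0, 1, ... of
  \<open>Splus_E\<close> and \<open>H_E\<close>.\<close>

lemma exists_bij_with_prefix:
  assumes "finite V" "distinct vs" "set vs \<subseteq> V"
  obtains g where "bij_betw g {0..<card V} V" "\<And>i. i < length vs \<Longrightarrow> g i = vs ! i"
proof -
  obtain us where us: "set us = V - set vs" "distinct us"
    using finite_distinct_list[of "V - set vs"] assms(1) by auto
  define ws where "ws = vs @ us"
  have ws: "distinct ws" "set ws = V" using us assms by (auto simp: ws_def)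
  then have "length ws = card V" by (metis distinct_card)
  then have "bij_betw ((!) ws) {0..<card V} V"
    by (intro bij_betw_nth[OF ws(1)]) (use ws(2) in \<open>simp_all add: atLeast0LessThan\<close>)
  moreover have "ws ! i = vs ! i" if "i < length vs" for i
    using that by (simp add: ws_def nth_append)
  ultimately show ?thesis using that by blast
qed

text \<open>A vertex bijection is injective on edge sets, so equal finite edge counts make the image
  of \<open>E2\<close> all of \<open>E1\<close>. Preserving edges in one direction is then enough;
  for unicyclic graphs on \<open>n\<close> vertices both counts are \<open>n\<close>.\<close>

lemma graph_isoI_bij_hom:
  assumes g: "bij_betw g V2 V1" and E2: "E2 \<subseteq> Pow V2" and E1: "finite E1"
    and hom: "\<And>e. e \<in> E2 \<Longrightarrow> g ` e \<in> E1" and card: "card E2 = card E1"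
  shows "graph_iso V1 E1 V2 E2"
proof -
  have inj: "inj_on ((`) g) (Pow V2)"
    using g by (simp add: bij_betw_def inj_on_image_Pow)
  have "card ((`) g ` E2) = card E1"
    using card card_image inj_on_subset[OF inj E2] by metis
  then have E1_eq: "(`) g ` E2 = E1"
    using hom by (intro card_subset_eq[OF E1]) auto
  define f where "f = inv_into V2 g"
  have f: "bij_betw f V1 V2" unfolding f_def by (rule bij_betw_inv_into[OF g])
  have gf: "g (f u) = u" "f u \<in> V2" if "u \<in> V1" for u
    using that g f unfolding f_def
    by (auto simp: bij_betw_inv_into_right bij_betw_apply)
  have "{u, v} \<in> E1 \<longleftrightarrow> {f u, f v} \<in> E2" if "u \<in> V1" "v \<in> V1" for u v
  proof
    assume "{u, v} \<in> E1"
    then obtain e where e: "e \<in> E2" "g ` e = {u, v}" using E1_eq by blast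
    have "g ` e = g ` {f u, f v}" using e gf that by simp
    then have "e = {f u, f v}"
      using inj e(1) E2 gf that by (intro inj_onD[OF inj]) auto
    with e show "{f u, f v} \<in> E2" by simp
  next
    assume "{f u, f v} \<in> E2"
    from hom[OF this] show "{u, v} \<in> E1" using gf that by simp
  qed
  with f show ?thesis unfolding graph_iso_def by blast
qed

text \<open>Edges, hence degrees, are carried across by the isomorphism. This gives the "if" halves
  of both equality statements.\<close>

lemma RRR_graph_iso:
  assumes iso: "graph_iso V1 E1 V2 E2" and sg: "simple_graph V1 E1" "simple_graph V2 E2"
  shows "RRR E1 = RRR E2"
proof -
  obtain f where f: "bij_betw f V1 V2"
    and fe: "\<And>u v. u \<in> V1 \<Longrightarrow> v \<in> V1 \<Longrightarrow> {u, v} \<in> E1 \<longleftrightarrow> {f u, f v} \<in> E2"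
    using iso unfolding graph_iso_def by blast
  have inj: "inj_on f V1" and img: "f ` V1 = V2" using f by (auto simp: bij_betw_def)
  have E2_eq: "E2 = (`) f ` E1"
  proof (intro equalityI subsetI)
    fix e assume e: "e \<in> E2"
    from sg(2) e obtain a b where ab: "a \<in> V2" "b \<in> V2" "e = {a, b}" by (rule simple_graph_edgeE)
    then obtain u v where "u \<in> V1" "v \<in> V1" "a = f u" "b = f v" using img by blast
    with ab e fe show "e \<in> (`) f ` E1" by (intro image_eqI[of _ _ "{u, v}"]) auto
  next
    fix e assume "e \<in> (`) f ` E1"
    then obtain d where d: "d \<in> E1" "e = f ` d" by blast
    from sg(1) d(1) obtain u v where "u \<in> V1" "v \<in> V1" "d = {u, v}" by (rule simple_graph_edgeE)
    with d fe show "e \<in> E2" by auto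
  qed
  have injE: "inj_on ((`) f) E1"
    using inj_on_subset[OF inj_on_image_Pow[OF inj] simple_graph_finite(3)[OF sg(1)]] .
  have deg: "degree E2 (f u) = degree E1 u" if "u \<in> V1" for u
  proof -
    have "{e \<in> E2. f u \<in> e} = (`) f ` {e \<in> E1. u \<in> e}"
    proof -
      have "f u \<in> f ` e \<longleftrightarrow> u \<in> e" if "e \<in> E1" for e
        using inj_on_image_mem_iff[OF inj \<open>u \<in> V1\<close>] simple_graph_finite(3)[OF sg(1)] that by blast
      then show ?thesis unfolding E2_eq by blast
    qed
    moreover have "inj_on ((`) f) {e \<in> E1. u \<in> e}" by (rule inj_on_subset[OF injE]) auto
    ultimately show ?thesis unfolding degree_def by (simp add: card_image)
  qed
  have "RRR E2 = (\<Sum>e\<in>E1. sqrt (\<Prod>x\<in>f ` e. real (degree E2 x) - 1))"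
    unfolding RRR_def by (subst E2_eq, subst sum.reindex[OF injE]) simp
  also have "\<dots> = RRR E1"
    unfolding RRR_def
  proof (intro sum.cong refl arg_cong[where f = sqrt])
    fix e assume "e \<in> E1"
    then have e: "e \<subseteq> V1" using simple_graph_finite(3)[OF sg(1)] by blast
    have "(\<Prod>x\<in>f ` e. real (degree E2 x) - 1) = (\<Prod>x\<in>e. real (degree E2 (f x)) - 1)"
      by (subst prod.reindex[OF inj_on_subset[OF inj e]]) simp
    also have "\<dots> = (\<Prod>x\<in>e. real (degree E1 x) - 1)"
      using e deg by (intro prod.cong) auto
    finally show "(\<Prod>x\<in>f ` e. real (degree E2 x) - 1) = (\<Prod>x\<in>e. real (degree E1 x) - 1)" .
  qed
  finally show ?thesis ..
qed

section \<open>The two extremal graphs: edge counts and RRR values\<close>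

lemma simple_graph_Un_star:
  assumes "finite V" "\<And>e. e \<in> A \<Longrightarrow> e \<subseteq> V \<and> card e = 2"
    and "c \<in> V" "K \<subseteq> V - {c}"
  shows "simple_graph V (A \<union> (\<lambda>k. {c, k}) ` K)"
  unfolding simple_graph_def
proof (intro conjI ballI assms(1))
  fix e assume "e \<in> A \<union> (\<lambda>k. {c, k}) ` K"
  then consider "e \<in> A" | k where "k \<in> K" "e = {c, k}" by blast
  then show "\<exists>u v. u \<noteq> v \<and> u \<in> V \<and> v \<in> V \<and> e = {u, v}"
  proof cases
    case 1
    from assms(2)[OF this] show ?thesis by (auto simp: card_2_iff)
  next
    case (2 k)
    then show ?thesis using assms(3,4) by (intro exI[of _ c] exI[of _ k]) auto
  qed
qed

text \<open>Separates the triangle from the pendent edges; only the triangle contributes to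
  RRR.\<close>

lemma Splus_E_eq:
  assumes "4 \<le> n"
  shows "Splus_E n = {{0, 1}, {0, 2}, {1, 2}} \<union> (\<lambda>k. {0, k}) ` {3..<n}"
proof -
  have "{1..<n} = {1, 2} \<union> {3..<n}" using assms by auto
  then have *: "(\<lambda>k. {0, k}) ` {1..<n} = {{0, 1}, {0, 2}} \<union> (\<lambda>k. {0, k}) ` {3..<n}"
    by (simp only: image_Un image_insert image_empty)
  have **: "{A, B} \<union> X \<union> {C} = {A, B, C} \<union> X" for A B C :: "nat set" and X
    by blast
  show ?thesis
    unfolding Splus_E_def setcompr_eq_image Collect_mem_eq * ** ..
qed

lemma simple_graph_Splus:
  assumes "4 \<le> n"
  shows "simple_graph (Splus_V n) (Splus_E n)"
  unfolding Splus_E_eq[OF assms] Splus_V_def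
proof (rule simple_graph_Un_star)
  show "e \<subseteq> {0..<n} \<and> card e = 2" if "e \<in> {{0, 1}, {0, 2}, {1, 2}}" for e
    using that assms by auto
qed (use assms in auto)

lemma Splus_disjoint: "{{0, 1}, {0, 2}, {1, 2}} \<inter> (\<lambda>k. {0::nat, k}) ` {3..<n} = {}"
  by (rule equals0I, elim IntE imageE) (simp add: doubleton_eq_iff)

lemma card_Splus_E:
  assumes "4 \<le> n"
  shows "card (Splus_E n) = n"
proof -
  have "card {{0::nat, 1}, {0, 2}, {1, 2}} = 3" by (simp add: doubleton_eq_iff)
  then have "card ({{0, 1}, {0, 2}, {1, 2}} \<union> (\<lambda>k. {0::nat, k}) ` {3..<n}) = 3 + (n - 3)"
    by (subst card_Un_disjoint[OF _ _ Splus_disjoint])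
      (simp_all add: card_image[OF inj_on_doubleton])
  then show ?thesis using assms by (simp add: Splus_E_eq)
qed

lemma RRR_Splus:
  assumes "4 \<le> n"
  shows "RRR (Splus_E n) = 1 + 2 * sqrt (real n - 2)"
proof -
  let ?E = "Splus_E n"
  note sg = simple_graph_Splus[OF assms]
  have nb: "{w. {0, w} \<in> ?E} = {1..<n}" "{w. {1, w} \<in> ?E} = {0, 2}" "{w. {2, w} \<in> ?E} = {0, 1}"
    "\<And>k. 3 \<le> k \<Longrightarrow> k < n \<Longrightarrow> {w. {k, w} \<in> ?E} = {0}"
    using assms by (auto simp: Splus_E_def doubleton_eq_iff)
  have deg: "degree ?E 0 = n - 1" "degree ?E 1 = 2" "degree ?E 2 = 2"
    "\<And>k. 3 \<le> k \<Longrightarrow> k < n \<Longrightarrow> degree ?E k = 1"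
    by (simp_all add: degree_eq_card_neighbours[OF sg] nb del: One_nat_def)
  let ?h = "\<lambda>e. sqrt (\<Prod>x\<in>e. real (degree ?E x) - 1)"
  have "RRR ?E = (\<Sum>e\<in>{{0, 1}, {0, 2}, {1, 2}}. ?h e) + (\<Sum>e\<in>(\<lambda>k. {0, k}) ` {3..<n}. ?h e)"
    unfolding RRR_def
    by (subst (1) Splus_E_eq[OF assms], rule sum.union_disjoint[OF _ _ Splus_disjoint]) simp_all
  also have "(\<Sum>e\<in>(\<lambda>k. {0, k}) ` {3..<n}. ?h e) = 0"
    by (rule sum.neutral) (auto simp: deg)
  also have "(\<Sum>e\<in>{{0, 1}, {0, 2}, {1, 2}}. ?h e) = 1 + 2 * sqrt (real n - 2)"
    using assms by (simp add: doubleton_eq_iff deg del: One_nat_def)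
  finally show ?thesis by simp
qed

lemma H_E_eq: "H_E n = {{0, 1}, {0, 2}, {1, 2}, {0, 3}, {3, 4}} \<union> (\<lambda>k. {4, k}) ` {5..<n}"
  unfolding H_E_def by (simp only: setcompr_eq_image Collect_mem_eq)

lemma simple_graph_H:
  assumes "6 \<le> n"
  shows "simple_graph (H_V n) (H_E n)"
  unfolding H_E_eq H_V_def
proof (rule simple_graph_Un_star)
  show "e \<subseteq> {0..<n} \<and> card e = 2" if "e \<in> {{0, 1}, {0, 2}, {1, 2}, {0, 3}, {3, 4}}" for e
    using that assms by auto
qed (use assms in auto)

lemma H_disjoint:
  "{{0, 1}, {0, 2}, {1, 2}, {0, 3}, {3, 4}} \<inter> (\<lambda>k. {4::nat, k}) ` {5..<n} = {}"
  by (rule equals0I, elim IntE imageE) (simp add: doubleton_eq_iff)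

lemma card_H_E:
  assumes "6 \<le> n"
  shows "card (H_E n) = n"
proof -
  have "card {{0::nat, 1}, {0, 2}, {1, 2}, {0, 3}, {3, 4}} = 5" by (simp add: doubleton_eq_iff)
  then have "card ({{0, 1}, {0, 2}, {1, 2}, {0, 3}, {3, 4}} \<union> (\<lambda>k. {4::nat, k}) ` {5..<n})
      = 5 + (n - 5)"
    by (subst card_Un_disjoint[OF _ _ H_disjoint])
      (simp_all add: card_image[OF inj_on_doubleton])
  then show ?thesis using assms by (simp add: H_E_eq)
qed

lemma RRR_H:
  assumes "6 \<le> n"
  shows "RRR (H_E n) = 1 + 3 * sqrt 2 + sqrt (real n - 5)"
proof -
  let ?E = "H_E n"
  note sg = simple_graph_H[OF assms]
  have nb: "{w. {0, w} \<in> ?E} = {1, 2, 3}" "{w. {1, w} \<in> ?E} = {0, 2}" "{w. {2, w} \<in> ?E} = {0, 1}"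
    "{w. {3, w} \<in> ?E} = {0, 4}" "{w. {4, w} \<in> ?E} = insert 3 {5..<n}"
    "\<And>k. 5 \<le> k \<Longrightarrow> k < n \<Longrightarrow> {w. {k, w} \<in> ?E} = {4}"
    using assms by (auto simp: H_E_def doubleton_eq_iff)
  have deg: "degree ?E 0 = 3" "degree ?E 1 = 2" "degree ?E 2 = 2" "degree ?E 3 = 2"
    "degree ?E 4 = n - 4" "\<And>k. 5 \<le> k \<Longrightarrow> k < n \<Longrightarrow> degree ?E k = 1"
    using assms by (simp_all add: degree_eq_card_neighbours[OF sg] nb del: One_nat_def)
  let ?h = "\<lambda>e. sqrt (\<Prod>x\<in>e. real (degree ?E x) - 1)"
  \<comment> \<open>These are the core edges of the graph; the star edges from 4 to the labels from
    5 on are pendent and contribute 0.\<close>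
  let ?A = "{{0, 1}, {0, 2}, {1, 2}, {0, 3}, {3, 4}} :: nat set set"
  have "RRR ?E = (\<Sum>e\<in>?A. ?h e) + (\<Sum>e\<in>(\<lambda>k. {4, k}) ` {5..<n}. ?h e)"
    unfolding RRR_def
    by (subst (1) H_E_eq, rule sum.union_disjoint[OF _ _ H_disjoint]) simp_all
  also have "(\<Sum>e\<in>(\<lambda>k. {4, k}) ` {5..<n}. ?h e) = 0"
    by (rule sum.neutral) (auto simp: deg)
  also have "(\<Sum>e\<in>?A. ?h e) = 1 + 3 * sqrt 2 + sqrt (real n - 5)"
    using assms by (simp add: doubleton_eq_iff deg del: One_nat_def)
  finally show ?thesis by simp
qed

section \<open>Inequalities between square roots\<close>

text \<open>Concavity of \<open>sqrt\<close> on \<open>[c, c + s]\<close>. In terms of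
  \<open>p\<close> and \<open>q\<close>, the difference of the squares is
  \<open>(a - a * a) * q\<^sup>2\<close>.\<close>

lemma sqrt_above_chord:
  fixes a c s :: real
  assumes "0 \<le> a" "a \<le> 1" "0 \<le> c" "0 \<le> s"
  shows "sqrt c + a * (sqrt (c + s) - sqrt c) \<le> sqrt (c + a * s)"
proof (rule real_le_rsqrt)
  define p q where "p = sqrt c" and "q = sqrt (c + s) - sqrt c"
  have c: "c = p\<^sup>2" and s: "s = q\<^sup>2 + 2 * p * q"
    using assms by (auto simp: p_def q_def power2_eq_square algebra_simps)
  have "a * a * q\<^sup>2 \<le> a * q\<^sup>2"
    using assms mult_left_le[of a a] by (intro mult_right_mono) auto
  then have "(p + a * q)\<^sup>2 \<le> c + a * s"
    unfolding c s by (simp add: power2_eq_square algebra_simps)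
  then show "(sqrt c + a * (sqrt (c + s) - sqrt c))\<^sup>2 \<le> c + a * s"
    by (simp add: p_def q_def)
qed

text \<open>The functions with lower bounds \<open>l\<close> and total excess \<open>s\<close> form
  a simplex, whose corners put all of \<open>s\<close> on one vertex; \<open>\<mu>\<close> gives the
  barycentric coordinates of \<open>x\<close>.\<close>

lemma exists_convex_weights:
  fixes x l :: "'a \<Rightarrow> real"
  assumes "finite V" "V \<noteq> {}" "\<And>v. v \<in> V \<Longrightarrow> l v \<le> x v" "(\<Sum>v\<in>V. x v - l v) = s"
  obtains \<mu> where "\<And>v. v \<in> V \<Longrightarrow> 0 \<le> \<mu> v" "\<And>v. v \<in> V \<Longrightarrow> \<mu> v \<le> 1" "(\<Sum>v\<in>V. \<mu> v) = 1"
    "\<And>v. v \<in> V \<Longrightarrow> x v = l v + \<mu> v * s" "0 \<le> s"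
proof -
  have s0: "0 \<le> s" using assms(3,4) sum_nonneg[of V "\<lambda>v. x v - l v"] by fastforce
  have "\<exists>\<mu>. (\<forall>v\<in>V. 0 \<le> \<mu> v) \<and> (\<Sum>v\<in>V. \<mu> v) = 1 \<and> (\<forall>v\<in>V. x v = l v + \<mu> v * s)"
  \<comment> \<open>For \<open>s = 0\<close> the simplex is a single point, so any weights with sum
    1 represent it; all weight is put on an arbitrary vertex.\<close>
  proof (cases "s = 0")
    case True
    then have eq: "\<forall>v\<in>V. x v - l v = 0"
      using assms sum_nonneg_eq_0_iff[of V "\<lambda>v. x v - l v"] by auto
    obtain u where "u \<in> V" using assms(2) by blast
    then show ?thesis
      using eq True assms(1) by (intro exI[of _ "\<lambda>v. if v = u then 1 else 0"]) auto
  next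
    case False
    then show ?thesis
      using assms s0
      by (intro exI[of _ "\<lambda>v. (x v - l v) / s"]) (auto simp: sum_divide_distrib[symmetric])
  qed
  then obtain \<mu> where \<mu>: "\<forall>v\<in>V. 0 \<le> \<mu> v" "(\<Sum>v\<in>V. \<mu> v) = 1" "\<forall>v\<in>V. x v = l v + \<mu> v * s" by blast
  moreover have "\<mu> v \<le> 1" if "v \<in> V" for v
    using member_le_sum[of v V \<mu>] \<mu> assms(1) that by auto
  ultimately show ?thesis using that s0 by blast
qed

section \<open>Comparisons between core sizes and between the extremal values\<close>

text \<open>Here \<open>m\<close> stands for the core size. Since
  \<open>m - 3 = (p - q) * (p + q)\<close>, the claim becomes
  \<open>2 * (p - q) \<le> (p - q) * (p + q)\<close>, which follows from \<open>p > 1\<close> and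
  \<open>q \<ge> 1\<close>.\<close>

lemma sqrt_shift_mono:
  fixes m n :: real
  assumes "3 \<le> m" "m \<le> n" "4 \<le> n"
  shows "1 + 2 * sqrt (n - 2) \<le> m + 2 * (sqrt (1 + n - m) - 1)"
    and "m \<noteq> 3 \<Longrightarrow> 1 + 2 * sqrt (n - 2) < m + 2 * (sqrt (1 + n - m) - 1)"
proof -
  define p q where "p = sqrt (n - 2)" and "q = sqrt (1 + n - m)"
  have p2: "p\<^sup>2 = n - 2" and q2: "q\<^sup>2 = 1 + n - m" using assms by (auto simp: p_def q_def)
  have p: "1 < p" and q: "1 \<le> q" using assms by (auto simp: p_def q_def)
  have "q \<le> p" using assms by (auto simp: p_def q_def)
  have m: "m - 3 = (p - q) * (p + q)" using p2 q2 by (simp add: power2_eq_square algebra_simps)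
  have "(p - q) * 2 \<le> (p - q) * (p + q)" using \<open>q \<le> p\<close> p q by (intro mult_left_mono) auto
  then show "1 + 2 * sqrt (n - 2) \<le> m + 2 * (sqrt (1 + n - m) - 1)"
    unfolding p_def[symmetric] q_def[symmetric] using m by simp
  assume "m \<noteq> 3"
  then have "q < p" using m \<open>q \<le> p\<close> by (cases "p = q") auto
  then have "(p - q) * 2 < (p - q) * (p + q)" using p q by (intro mult_strict_left_mono) auto
  then show "1 + 2 * sqrt (n - 2) < m + 2 * (sqrt (1 + n - m) - 1)"
    unfolding p_def[symmetric] q_def[symmetric] using m by simp
qed

text \<open>The same factorisation, of \<open>m - 5\<close>. Now \<open>p + q \<ge> 1\<close> is
  enough, and \<open>m \<le> n - 1\<close> gives \<open>q \<ge> 1\<close>.\<close>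

lemma sqrt_shift_mono1:
  fixes m n :: real
  assumes "5 \<le> m" "m \<le> n - 1"
  shows "5 + sqrt (n - 5) \<le> m + sqrt (n - m)"
    and "m \<noteq> 5 \<Longrightarrow> 5 + sqrt (n - 5) < m + sqrt (n - m)"
proof -
  define p q where "p = sqrt (n - 5)" and "q = sqrt (n - m)"
  have p2: "p\<^sup>2 = n - 5" and q2: "q\<^sup>2 = n - m" using assms by (auto simp: p_def q_def)
  have q: "1 \<le> q" and qp: "q \<le> p" using assms by (auto simp: p_def q_def)
  have m: "m - 5 = (p - q) * (p + q)" using p2 q2 by (simp add: power2_eq_square algebra_simps)
  have "(p - q) * 1 \<le> (p - q) * (p + q)" using q qp by (intro mult_left_mono) auto
  then show "5 + sqrt (n - 5) \<le> m + sqrt (n - m)"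
    unfolding p_def[symmetric] q_def[symmetric] using m by simp
  assume "m \<noteq> 5"
  then have "q < p" using m qp by (cases "p = q") auto
  then have "(p - q) * 1 < (p - q) * (p + q)" using q by (intro mult_strict_left_mono) auto
  then show "5 + sqrt (n - 5) < m + sqrt (n - m)"
    unfolding p_def[symmetric] q_def[symmetric] using m by simp
qed

lemma sqrt_2_bounds: "141 / 100 < sqrt 2" "sqrt 2 < 142 / 100"
proof -
  show "141 / 100 < sqrt 2" by (rule real_less_rsqrt) (simp add: power2_eq_square)
  show "sqrt 2 < 142 / 100" by (rule real_less_lsqrt) (simp_all add: power2_eq_square)
qed

text \<open>With \<open>p = sqrt (n - 2)\<close>, comparing the two extremal values amounts to the sign of
  \<open>p\<^sup>2 - 4 * sqrt 2 * p + 7\<close>, whose roots are \<open>2 * sqrt 2 \<plusminus> 1\<close>.\<close>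

lemma H_value_less_Splus_value:
  fixes n :: real
  assumes "17 \<le> n"
  shows "1 + 3 * sqrt 2 + sqrt (n - 5) < 1 + 2 * sqrt (n - 2)"
proof -
  define p where "p = sqrt (n - 2)"
  have p2: "p\<^sup>2 = n - 2" using assms by (simp add: p_def)
  \<comment> \<open>The constant lies between \<open>2 * 1.42 + 1 = 3.84\<close> and
    \<open>sqrt 15\<close>, the value of \<open>p\<close> at \<open>n = 17\<close>.\<close>
  have "387 / 100 < p" unfolding p_def using assms
    by (intro real_less_rsqrt) (simp add: power2_eq_square)
  then have p: "2 * sqrt 2 + 1 < p" using sqrt_2_bounds by simp
  then have "0 < (p - (2 * sqrt 2 + 1)) * (p - (2 * sqrt 2 - 1))"
    using sqrt_2_bounds by (intro mult_pos_pos) auto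
  then have "n - 5 < (2 * p - 3 * sqrt 2)\<^sup>2"
    using p2 by (simp add: power2_eq_square algebra_simps)
  then have "sqrt (n - 5) < 2 * p - 3 * sqrt 2"
    using p sqrt_2_bounds by (intro real_less_lsqrt) auto
  then show ?thesis by (simp add: p_def)
qed

lemma Splus_value_less_H_value:
  fixes n :: real
  assumes "6 \<le> n" "n \<le> 16"
  shows "1 + 2 * sqrt (n - 2) < 1 + 3 * sqrt 2 + sqrt (n - 5)"
proof -
  define p where "p = sqrt (n - 2)"
  have p2: "p\<^sup>2 = n - 2" using assms by (simp add: p_def)
  \<comment> \<open>At \<open>n = 16\<close> the value \<open>sqrt 14\<close> is below 3.75, whereas
    \<open>2 * sqrt 2 + 1\<close> exceeds 3.82.\<close>
  have "p < 375 / 100" unfolding p_def using assms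
    by (intro real_less_lsqrt) (simp_all add: power2_eq_square)
  then have p: "p < 2 * sqrt 2 + 1" using sqrt_2_bounds by simp
  \<comment> \<open>This is where \<open>n \<ge> 6\<close> enters: it puts \<open>p\<close> above
    the smaller root \<open>2 * sqrt 2 - 1 < 1.84\<close>.\<close>
  have "2 \<le> p" unfolding p_def using assms by (intro real_le_rsqrt) auto
  then have "0 < ((2 * sqrt 2 + 1) - p) * (p - (2 * sqrt 2 - 1))"
    using p sqrt_2_bounds by (intro mult_pos_pos) auto
  then have "(2 * p - 3 * sqrt 2)\<^sup>2 < n - 5"
    using p2 by (simp add: power2_eq_square algebra_simps)
  then have "2 * p - 3 * sqrt 2 < sqrt (n - 5)" by (rule real_less_rsqrt)
  then show ?thesis by (simp add: p_def)
qed

text \<open>The right side is the bound for a core with four vertices. As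
  \<open>sqrt (n - 5) < r\<close>, it suffices that \<open>sqrt 2 < (sqrt 2 - 1) * r\<close>; the
  decimals give \<open>1.42 < 0.41 * 3.6\<close>.\<close>

lemma H_value_less_paw_value:
  fixes n :: real
  assumes "17 \<le> n"
  shows "1 + 3 * sqrt 2 + sqrt (n - 5) < 1 + 2 * sqrt 2 + sqrt 2 * sqrt (n - 4)"
proof -
  define r where "r = sqrt (n - 4)"
  have r: "36 / 10 < r" unfolding r_def using assms
    by (intro real_less_rsqrt) (simp add: power2_eq_square)
  have "sqrt (n - 5) < r" using assms by (simp add: r_def)
  moreover have "(41 / 100) * r \<le> (sqrt 2 - 1) * r"
    using r sqrt_2_bounds by (intro mult_right_mono) auto
  moreover have "(sqrt 2 - 1) * r = sqrt 2 * r - r" by (simp add: algebra_simps)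
  ultimately have "sqrt 2 + sqrt (n - 5) < sqrt 2 * r"
    using sqrt_2_bounds r by linarith
  then show ?thesis by (simp add: r_def)
qed

text \<open>After subtracting 1 and halving, the squares of the two sides differ by
  \<open>r * (4 - r) / 2\<close>, which is positive for \<open>0 < r < 4\<close>.\<close>

lemma Splus_value_less_paw_value:
  fixes n :: real
  assumes "5 \<le> n" "n \<le> 16"
  shows "1 + 2 * sqrt (n - 2) < 1 + 2 * sqrt 2 + sqrt 2 * sqrt (n - 4)"
proof -
  define r where "r = sqrt (n - 4)"
  have r2: "r\<^sup>2 = n - 4" using assms by (simp add: r_def)
  have "0 < r" "r < 4" using assms by (auto simp: r_def intro!: real_less_lsqrt)
  then have "0 < r * (4 - r)" by simp
  then have "n - 2 < (sqrt 2 + sqrt 2 * r / 2)\<^sup>2"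
    using r2 by (simp add: power2_eq_square algebra_simps)
  then have "sqrt (n - 2) < sqrt 2 + sqrt 2 * r / 2"
    using \<open>0 < r\<close> by (intro real_less_lsqrt) auto
  then show ?thesis by (simp add: r_def)
qed

section \<open>Concavity bounds for edge sums\<close>

text \<open>At each end of an edge \<open>sqrt (x v)\<close> is at least the chord value
  \<open>1 + \<mu> v * \<delta>\<close>; multiplying gives a constant, linear terms and a product
  term. The product terms are kept because their vanishing identifies the equality case.\<close>

lemma edge_sum_bound_min_degree_2:
  fixes x :: "'a \<Rightarrow> real" and N \<delta> :: real
  assumes sg: "simple_graph V E" and card: "card E = card V" and "V \<noteq> {}"
    and x1: "\<And>v. v \<in> V \<Longrightarrow> 1 \<le> x v" and sum_x: "(\<Sum>v\<in>V. x v) = N"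
    and deg: "\<And>v. v \<in> V \<Longrightarrow> 2 \<le> degree E v"
    and \<delta>_def: "\<delta> = sqrt (1 + N - card V) - 1"
  obtains \<mu> :: "'a \<Rightarrow> real" where "\<And>v. v \<in> V \<Longrightarrow> 0 \<le> \<mu> v" "(\<Sum>v\<in>V. \<mu> v) = 1"
    "\<And>v. v \<in> V \<Longrightarrow> x v = 1 + \<mu> v * (N - card V)" "card V \<le> N"
    "card V + 2 * \<delta> + \<delta>\<^sup>2 * (\<Sum>e\<in>E. \<Prod>v\<in>e. \<mu> v) \<le> (\<Sum>e\<in>E. sqrt (\<Prod>v\<in>e. x v))"
proof -
  note fin = simple_graph_finite[OF sg]
  have x0: "0 \<le> x v" if "v \<in> V" for v using x1[OF that] by simp
  define s where "s = N - card V"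
  have "(\<Sum>v\<in>V. x v - 1) = s" using sum_x by (simp add: s_def sum_subtractf)
  then obtain \<mu> where \<mu>: "\<And>v. v \<in> V \<Longrightarrow> 0 \<le> \<mu> v" "\<And>v. v \<in> V \<Longrightarrow> \<mu> v \<le> 1" "(\<Sum>v\<in>V. \<mu> v) = 1"
    "\<And>v. v \<in> V \<Longrightarrow> x v = 1 + \<mu> v * s" and s0: "0 \<le> s"
    using exists_convex_weights[of V "\<lambda>_. 1" x s] fin(1) \<open>V \<noteq> {}\<close> x1 by blast
  have \<delta>: "\<delta> = sqrt (1 + s) - 1" by (simp add: \<delta>_def s_def add_diff_eq)
  have \<delta>0: "0 \<le> \<delta>" using s0 by (simp add: \<delta>)
  have chord: "1 + \<mu> v * \<delta> \<le> sqrt (x v)" if "v \<in> V" for v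
    using sqrt_above_chord[of "\<mu> v" 1 s] \<mu> s0 that by (simp add: \<delta>)
  have edge: "1 + (\<Sum>v\<in>e. \<mu> v * \<delta>) + \<delta>\<^sup>2 * (\<Prod>v\<in>e. \<mu> v) \<le> sqrt (\<Prod>v\<in>e. x v)" if "e \<in> E" for e
  proof -
    from sg that obtain u w where uw: "u \<noteq> w" "u \<in> V" "w \<in> V" "e = {u, w}"
      by (rule simple_graph_edgeE)
    have "(1 + \<mu> u * \<delta>) * (1 + \<mu> w * \<delta>) \<le> sqrt (x u) * sqrt (x w)"
      using chord uw \<delta>0 \<mu>(1) x0 by (intro mult_mono) auto
    then show ?thesis
      using uw by (simp add: real_sqrt_mult algebra_simps power2_eq_square)
  qed
  \<comment> \<open>The weights sum to 1 and each vertex lies on at least two edges, so the linear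
    terms total at least \<open>2 * \<delta>\<close>.\<close>
  have "2 * \<delta> = (\<Sum>v\<in>V. 2 * (\<mu> v * \<delta>))"
    using \<mu>(3) by (simp add: sum_distrib_left[symmetric] sum_distrib_right[symmetric])
  also have "\<dots> \<le> (\<Sum>v\<in>V. real (degree E v) * (\<mu> v * \<delta>))"
    using deg \<mu>(1) \<delta>0 by (intro sum_mono mult_right_mono) (auto simp: of_nat_le_iff[of 2, simplified])
  also have "\<dots> = (\<Sum>e\<in>E. \<Sum>v\<in>e. \<mu> v * \<delta>)" by (rule sum_edges_sum_vertices[OF sg, symmetric])
  finally have "card V + 2 * \<delta> + \<delta>\<^sup>2 * (\<Sum>e\<in>E. \<Prod>v\<in>e. \<mu> v)
      \<le> (\<Sum>e\<in>E. 1 + (\<Sum>v\<in>e. \<mu> v * \<delta>) + \<delta>\<^sup>2 * (\<Prod>v\<in>e. \<mu> v))"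
    by (simp add: sum.distrib sum_distrib_left card)
  also have "\<dots> \<le> (\<Sum>e\<in>E. sqrt (\<Prod>v\<in>e. x v))" by (intro sum_mono edge)
  finally show ?thesis using that[of \<mu>] \<mu> s0 by (simp add: s_def)
qed

text \<open>The same method with lower bound 2 at \<open>y\<close>: there the chord starts at
  \<open>sqrt 2\<close> and rises by \<open>\<epsilon>\<close>, elsewhere it starts at 1 and rises
  by \<open>\<delta>\<close>. The raised bound takes 1 from the total excess. The sums over
  \<open>V\<close> and over the neighbours of \<open>y\<close> stay unevaluated, since cores of size
  4 and larger cores use them differently.\<close>

lemma edge_sum_bound_branch_vertex:
  fixes x :: "'a \<Rightarrow> real" and N \<delta> \<epsilon> :: real
  assumes sg: "simple_graph V E" and card: "card E = card V"
    and x1: "\<And>v. v \<in> V \<Longrightarrow> 1 \<le> x v" and sum_x: "(\<Sum>v\<in>V. x v) = N"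
    and y: "y \<in> V" "2 \<le> x y"
    and \<delta>_def: "\<delta> = sqrt (N - card V) - 1"
    and \<epsilon>_def: "\<epsilon> = sqrt (N - card V + 1) - sqrt 2"
  obtains \<mu> :: "'a \<Rightarrow> real" where "\<And>v. v \<in> V \<Longrightarrow> 0 \<le> \<mu> v" "(\<Sum>v\<in>V. \<mu> v) = 1"
    "\<And>v. v \<in> V \<Longrightarrow> x v = (if v = y then 2 else 1) + \<mu> v * (N - card V - 1)" "real (card V) + 1 \<le> N"
    "card V + (\<Sum>v\<in>V. degree E v * (\<mu> v * (if v = y then \<epsilon> else \<delta>)))
       + (sqrt 2 - 1) * (degree E y + (\<Sum>w | {y, w} \<in> E. \<mu> w * \<delta>))
      \<le> (\<Sum>e\<in>E. sqrt (\<Prod>v\<in>e. x v))"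
proof -
  note fin = simple_graph_finite[OF sg]
  have x0: "0 \<le> x v" if "v \<in> V" for v using x1[OF that] by simp
  define s where "s = N - card V - 1"
  let ?l = "\<lambda>v. if v = y then 2 else 1 :: real"
  have "(\<Sum>v\<in>V. ?l v) = (\<Sum>v\<in>V. 1 + (if v = y then 1 else 0))" by (intro sum.cong) auto
  then have "(\<Sum>v\<in>V. ?l v) = card V + 1" using y fin(1) by (simp add: sum.distrib)
  then have "(\<Sum>v\<in>V. x v - ?l v) = s" using sum_x by (simp add: s_def sum_subtractf)
  moreover have "?l v \<le> x v" if "v \<in> V" for v using x1 y that by auto
  ultimately obtain \<mu> where \<mu>: "\<And>v. v \<in> V \<Longrightarrow> 0 \<le> \<mu> v" "\<And>v. v \<in> V \<Longrightarrow> \<mu> v \<le> 1" "(\<Sum>v\<in>V. \<mu> v) = 1"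
    "\<And>v. v \<in> V \<Longrightarrow> x v = ?l v + \<mu> v * s" and s0: "0 \<le> s"
    using exists_convex_weights[of V ?l x s] fin(1) y(1) by blast
  have \<delta>: "\<delta> = sqrt (1 + s) - 1" and \<epsilon>: "\<epsilon> = sqrt (2 + s) - sqrt 2"
    by (simp_all add: \<delta>_def \<epsilon>_def s_def add.commute)
  have \<delta>0: "0 \<le> \<delta>" and \<epsilon>0: "0 \<le> \<epsilon>" using s0 by (simp_all add: \<delta> \<epsilon>)
  define g where "g v = \<mu> v * (if v = y then \<epsilon> else \<delta>)" for v
  have g0: "0 \<le> g v" if "v \<in> V" for v using \<mu>(1) \<delta>0 \<epsilon>0 that by (simp add: g_def)
  have chord: "1 + g v \<le> sqrt (x v)" if "v \<in> V" "v \<noteq> y" for v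
    using sqrt_above_chord[of "\<mu> v" 1 s] \<mu> s0 that by (simp add: \<delta> g_def)
  have chord_y: "sqrt 2 + g y \<le> sqrt (x y)"
    using sqrt_above_chord[of "\<mu> y" 2 s] \<mu> s0 y by (simp add: \<epsilon> g_def)
  \<comment> \<open>The gain of an edge at \<open>y\<close> from having \<open>sqrt 2\<close>
    instead of 1 as constant term of one factor; \<open>e - {y}\<close> picks out the other
    end.\<close>
  let ?r = "\<lambda>e. if y \<in> e then (sqrt 2 - 1) * (1 + (\<Sum>v\<in>e - {y}. \<mu> v * \<delta>)) else 0"
  have edge_y: "1 + (\<Sum>v\<in>{y, w}. g v) + ?r {y, w} \<le> sqrt (\<Prod>v\<in>{y, w}. x v)"
    if "w \<in> V" "w \<noteq> y" for w
  proof -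
    have "(sqrt 2 + g y) * (1 + g w) \<le> sqrt (x y) * sqrt (x w)"
      using chord[OF that] chord_y g0 that y by (intro mult_mono) auto
    moreover have "(sqrt 2 + g y) * (1 + g w)
        = 1 + (g y + g w) + (sqrt 2 - 1) * (1 + g w) + g y * g w" by (simp add: algebra_simps)
    \<comment> \<open>The product is dropped here: the remaining terms suffice for the equality
      case.\<close>
    moreover have "0 \<le> g y * g w" using g0 that y by simp
    moreover have "\<mu> w * \<delta> = g w" using that by (simp add: g_def)
    moreover have "{y, w} - {y} = {w}" using that by auto
    ultimately show ?thesis using that by (simp add: real_sqrt_mult)
  qed
  have edge: "1 + (\<Sum>v\<in>e. g v) + ?r e \<le> sqrt (\<Prod>v\<in>e. x v)" if "e \<in> E" for e
  proof -
    from sg that obtain u w where uw: "u \<noteq> w" "u \<in> V" "w \<in> V" "e = {u, w}"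
      by (rule simple_graph_edgeE)
    show ?thesis
    proof (cases "y \<in> e")
      case True
      then obtain w' where w': "e = {y, w'}" "w' \<noteq> y" "w' \<in> V" using uw by (auto simp: insert_commute)
      show ?thesis unfolding w'(1) by (rule edge_y[OF w'(3,2)])
    next
      case False
      have "(1 + g u) * (1 + g w) \<le> sqrt (x u) * sqrt (x w)"
        using chord False uw g0 x0 by (intro mult_mono) auto
      moreover have "(1 + g u) * (1 + g w) = 1 + (g u + g w) + g u * g w" by (simp add: algebra_simps)
      moreover have "0 \<le> g u * g w" using g0 uw by simp
      ultimately show ?thesis using uw False by (simp add: real_sqrt_mult)
    qed
  qed
  have "(\<Sum>e\<in>E. ?r e) = (\<Sum>e | e \<in> E \<and> y \<in> e. (sqrt 2 - 1) * (1 + (\<Sum>v\<in>e - {y}. \<mu> v * \<delta>)))"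
    using fin(2) by (simp add: sum.inter_filter)
  also have "\<dots> = (\<Sum>w | {y, w} \<in> E. (sqrt 2 - 1) * (1 + (\<Sum>v\<in>{y, w} - {y}. \<mu> v * \<delta>)))"
    unfolding incident_edges_eq_image[OF sg] by (subst sum.reindex[OF inj_on_doubleton]) simp
  also have "\<dots> = (\<Sum>w | {y, w} \<in> E. (sqrt 2 - 1) * (1 + \<mu> w * \<delta>))"
  proof (rule sum.cong[OF refl])
    fix w assume "w \<in> {w. {y, w} \<in> E}"
    then have "{y, w} - {y} = {w}" using simple_graph_edgeD(1)[OF sg, of y w] by blast
    then show "(sqrt 2 - 1) * (1 + (\<Sum>v\<in>{y, w} - {y}. \<mu> v * \<delta>)) = (sqrt 2 - 1) * (1 + \<mu> w * \<delta>)"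
      by simp
  qed
  also have "\<dots> = (sqrt 2 - 1) * (degree E y + (\<Sum>w | {y, w} \<in> E. \<mu> w * \<delta>))"
    by (simp add: degree_eq_card_neighbours[OF sg] sum.distrib sum_distrib_left[symmetric])
  finally have r: "(\<Sum>e\<in>E. ?r e) = \<dots>" .
  have "(\<Sum>e\<in>E. 1 + (\<Sum>v\<in>e. g v) + ?r e) \<le> (\<Sum>e\<in>E. sqrt (\<Prod>v\<in>e. x v))"
    by (intro sum_mono edge)
  then have "card V + (\<Sum>v\<in>V. degree E v * g v)
       + (sqrt 2 - 1) * (degree E y + (\<Sum>w | {y, w} \<in> E. \<mu> w * \<delta>))
      \<le> (\<Sum>e\<in>E. sqrt (\<Prod>v\<in>e. x v))"
    unfolding sum.distrib r sum_edges_sum_vertices[OF sg] by (simp add: card)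
  then show ?thesis using that[of \<mu>] \<mu> s0 by (simp add: s_def g_def)
qed

text \<open>Reduces to \<open>(t + 1)\<^sup>2 \<le> 2 * (t\<^sup>2 + 1)\<close>, that is
  \<open>0 \<le> (t - 1)\<^sup>2\<close>. With \<open>t = sqrt (n - m)\<close> it compares the two
  rises: \<open>\<epsilon> \<ge> \<delta> / sqrt 2\<close>.\<close>

lemma sqrt_increment_compare:
  fixes t :: real
  assumes "1 \<le> t"
  shows "(t - 1) / sqrt 2 \<le> sqrt (t\<^sup>2 + 1) - sqrt 2"
proof -
  have "((t + 1) / sqrt 2)\<^sup>2 \<le> t\<^sup>2 + 1"
    using zero_le_power2[of "t - 1"] by (simp add: power2_eq_square field_simps)
  then have "(t + 1) / sqrt 2 \<le> sqrt (t\<^sup>2 + 1)" by (rule real_le_rsqrt)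
  moreover have "(t + 1) / sqrt 2 = (t - 1) / sqrt 2 + sqrt 2"
    by (simp add: field_simps)
  ultimately show ?thesis by simp
qed

section \<open>The core of a unicyclic graph\<close>

text \<open>Induction along a walk from \<open>u\<close>; this is the form in which connectedness is
  used.\<close>

lemma connected_graph_subset_closed:
  assumes "connected_graph V E" "u \<in> V" "u \<in> S"
    and closed: "\<And>a b. a \<in> S \<Longrightarrow> {a, b} \<in> E \<Longrightarrow> b \<in> S"
  shows "V \<subseteq> S"
proof
  fix v assume "v \<in> V"
  then have "(adj E)\<^sup>*\<^sup>* u v" using assms(1,2) by (simp add: connected_graph_def)
  then show "v \<in> S"
    by (induction rule: rtranclp_induct) (use assms(3) closed in \<open>auto simp: adj_def\<close>)
qed

locale unicyclic_graph =
  fixes V :: "'a set" and E :: "'a set set" and n :: nat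
  assumes uni: "unicyclic V E" and card_V: "card V = n" and n4: "4 \<le> n"
begin

text \<open>Degrees are those of the whole graph, so a core vertex may be a leaf of the
  core.\<close>

definition core :: "'a set" where
  "core = {v \<in> V. 2 \<le> degree E v}"

definition core_edges :: "'a set set" where
  "core_edges = {e \<in> E. e \<subseteq> core}"

abbreviation x :: "'a \<Rightarrow> real" where
  "x v \<equiv> real (degree E v) - 1"

lemma unicyclic_simple: "simple_graph V E" and unicyclic_connected: "connected_graph V E"
  and card_E: "card E = n"
  using uni card_V by (auto simp: unicyclic_def)

lemma core_subset: "core \<subseteq> V" and core_edges_subset: "core_edges \<subseteq> E"
  by (auto simp: core_def core_edges_def)

lemma core_simple: "simple_graph core core_edges"
  by (rule simple_graph_mono[OF unicyclic_simple core_edges_subset core_subset])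
    (auto simp: core_edges_def)

lemma not_closed_small:
  assumes "u \<in> V" "finite S" "card S < n" "u \<in> S"
  shows "\<exists>a\<in>S. \<exists>b. {a, b} \<in> E \<and> b \<notin> S"
proof (rule ccontr)
  assume "\<not> ?thesis"
  then have "V \<subseteq> S"
    using connected_graph_subset_closed[OF unicyclic_connected assms(1,4)] by blast
  then have "card V \<le> card S" by (rule card_mono[OF assms(2)])
  then show False using assms(3) card_V by simp
qed

lemma degree_ge_1:
  assumes "v \<in> V"
  shows "1 \<le> degree E v"
proof -
  obtain b where "{v, b} \<in> E" using not_closed_small[OF assms, of "{v}"] n4 by auto
  then have "{w. {v, w} \<in> E} \<noteq> {}" by blast
  then have "0 < card {w. {v, w} \<in> E}"
    using finite_neighbours(1)[OF unicyclic_simple] by (simp add: card_gt_0_iff)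
  then show ?thesis by (simp add: degree_eq_card_neighbours[OF unicyclic_simple])
qed

lemma degree_leaf: "v \<in> V - core \<Longrightarrow> degree E v = 1"
  using degree_ge_1[of v] by (auto simp: core_def)

lemma leaf_neighbour_unique:
  assumes "u \<in> V - core" "{u, a} \<in> E" "{u, b} \<in> E"
  shows "a = b"
proof -
  have "card {w. {u, w} \<in> E} = 1"
    using degree_leaf[OF assms(1)] by (simp add: degree_eq_card_neighbours[OF unicyclic_simple])
  then obtain c where c: "{w. {u, w} \<in> E} = {c}" by (rule card_1_singletonE)
  have "a \<in> {w. {u, w} \<in> E}" "b \<in> {w. {u, w} \<in> E}" using assms(2,3) by auto
  then show ?thesis unfolding c by simp
qed

text \<open>Two adjacent leaves would form a component with two vertices, against
  \<open>n \<ge> 4\<close>.\<close>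

lemma leaves_not_adjacent:
  assumes "u \<in> V - core" "w \<in> V - core"
  shows "{u, w} \<notin> E"
proof
  assume uw: "{u, w} \<in> E"
  have "card {u, w} \<le> 2" by (simp add: card_insert_if)
  then obtain a b where "a \<in> {u, w}" "{a, b} \<in> E" "b \<notin> {u, w}"
    using not_closed_small[of u "{u, w}"] assms n4 by auto
  then show False
    using leaf_neighbour_unique[OF assms(1) uw, of b] leaf_neighbour_unique[OF assms(2), of u b] uw
    by (auto simp: insert_commute)
qed

text \<open>Each edge outside the core has exactly one leaf end, and each leaf has exactly one edge.
  Deleting the leaves therefore removes as many edges as vertices; \<open>g\<close> is the indicator
  of leaves.\<close>

lemma core_card: "card core_edges = card core"
proof -
  note fin = simple_graph_finite[OF unicyclic_simple]
  define g where "g v = (if v \<in> core then 0 else 1 :: real)" for v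
  have "(\<Sum>e\<in>E. \<Sum>v\<in>e. g v) = (\<Sum>e\<in>E. if e \<in> E - core_edges then 1 else 0)"
  proof (rule sum.cong[OF refl])
    fix e assume e: "e \<in> E"
    from unicyclic_simple e obtain u w where uw: "u \<noteq> w" "u \<in> V" "w \<in> V" "e = {u, w}"
      by (rule simple_graph_edgeE)
    then have "u \<in> core \<or> w \<in> core" using leaves_not_adjacent[of u w] e by blast
    then show "(\<Sum>v\<in>e. g v) = (if e \<in> E - core_edges then 1 else 0)"
      using uw e by (auto simp: g_def core_edges_def)
  qed
  also have "\<dots> = card (E - core_edges)"
    using fin(2) by (simp add: sum.inter_filter[symmetric] set_diff_eq)
  finally have "real (card (E - core_edges)) = (\<Sum>v\<in>V. real (degree E v) * g v)"
    by (simp add: sum_edges_sum_vertices[OF unicyclic_simple])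
  also have "\<dots> = (\<Sum>v\<in>V. if v \<in> V - core then 1 else 0)"
    using degree_leaf by (intro sum.cong) (auto simp: g_def)
  also have "\<dots> = card (V - core)"
    using fin(1) by (simp add: sum.inter_filter[symmetric] set_diff_eq)
  finally have "card (E - core_edges) = card (V - core)" by simp
  moreover have "card (E - core_edges) = n - card core_edges" "card (V - core) = n - card core"
      "card core_edges \<le> n" "card core \<le> n"
    using card_Diff_subset[OF finite_subset[OF core_subset fin(1)] core_subset]
      card_Diff_subset[OF finite_subset[OF core_edges_subset fin(2)] core_edges_subset]
      card_mono[OF fin(1) core_subset] card_mono[OF fin(2) core_edges_subset] card_E card_V
    by simp_all
  ultimately show ?thesis by simp
qed

text \<open>Over all of \<open>V\<close> the sum is \<open>2 * n - n\<close> by the handshake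
  identity, and leaves have \<open>x v = 0\<close>.\<close>

lemma sum_core: "(\<Sum>v\<in>core. x v) = n"
proof -
  note fin = simple_graph_finite[OF unicyclic_simple]
  have "(\<Sum>v\<in>core. x v) = (\<Sum>v\<in>V. x v)"
    using degree_leaf core_subset by (intro sum.mono_neutral_left fin) auto
  also have "\<dots> = real (\<Sum>v\<in>V. degree E v) - n"
    by (simp add: sum_subtractf card_V)
  also have "\<dots> = n" by (simp add: handshake[OF unicyclic_simple] card_E)
  finally show ?thesis .
qed

lemma core_nonempty: "core \<noteq> {}"
  using sum_core n4 by auto

text \<open>A graph on \<open>m\<close> vertices has at most \<open>m choose 2\<close> edges; having
  \<open>m\<close> of them with \<open>m > 0\<close> forces \<open>m \<ge> 3\<close>.\<close>

lemma core_card_ge_3: "3 \<le> card core"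
proof -
  note fin = simple_graph_finite[OF core_simple]
  have "core_edges \<subseteq> {e. e \<subseteq> core \<and> card e = 2}"
    using fin(3) simple_graph_edge_card[OF core_simple] by auto
  then have "card core_edges \<le> card core choose 2"
    using card_mono[of "{e. e \<subseteq> core \<and> card e = 2}"] fin(1) by (simp add: n_subsets)
  then have "card core \<le> card core choose 2" by (simp add: core_card)
  moreover have "card core \<noteq> 0" using core_nonempty fin(1) by simp
  moreover have "c \<noteq> 1 \<and> c \<noteq> 2" if "c \<le> c choose 2" for c :: nat
    using that by (auto simp: choose_two)
  ultimately have "card core \<noteq> 0 \<and> card core \<noteq> 1 \<and> card core \<noteq> 2" by blast
  then show ?thesis by linarith
qed

text \<open>If all neighbours of \<open>v\<close> were leaves, \<open>v\<close> and its neighbours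
  would make up the whole graph and the core would be \<open>{v}\<close>.\<close>

lemma core_degree_ge_1:
  assumes "v \<in> core"
  shows "1 \<le> degree core_edges v"
proof (rule ccontr)
  assume "\<not> 1 \<le> degree core_edges v"
  then have "card {e \<in> core_edges. v \<in> e} = 0" by (simp add: degree_def)
  moreover have "finite {e \<in> core_edges. v \<in> e}" using simple_graph_finite(2)[OF core_simple] by simp
  ultimately have none: "{e \<in> core_edges. v \<in> e} = {}" by simp
  have nb: "w \<in> V - core" if vw: "{v, w} \<in> E" for w
  proof -
    have "w \<notin> core"
    proof
      assume "w \<in> core"
      then have "{v, w} \<in> {e \<in> core_edges. v \<in> e}" using vw assms by (simp add: core_edges_def)
      then show False by (simp only: none empty_iff)
    qed
    then show ?thesis using simple_graph_edgeD(3)[OF unicyclic_simple vw] by blast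
  qed
  let ?S = "insert v {w. {v, w} \<in> E}"
  have "V \<subseteq> ?S"
  proof (rule connected_graph_subset_closed[OF unicyclic_connected, of v])
    fix a b assume ab: "a \<in> ?S" "{a, b} \<in> E"
    show "b \<in> ?S"
    proof (cases "a = v")
      case True then show ?thesis using ab(2) by simp
    next
      case False
      then have va: "{v, a} \<in> E" using ab(1) by simp
      have "b = v"
        by (rule leaf_neighbour_unique[OF nb[OF va] ab(2)]) (use va in \<open>simp add: insert_commute\<close>)
      then show ?thesis by simp
    qed
  qed (use assms core_subset in auto)
  then have "V \<subseteq> insert v (V - core)" using nb by blast
  then have "core \<subseteq> {v}" using core_subset by blast
  then have "card core \<le> 1" using card_mono[of "{v}" core] by simp
  then show False using core_card_ge_3 by simp
qed

lemma core_degree_le: "v \<in> core \<Longrightarrow> degree core_edges v \<le> degree E v"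
  unfolding degree_def using simple_graph_finite(2)[OF unicyclic_simple] core_edges_subset
  by (intro card_mono) auto

lemma RRR_core: "RRR E = (\<Sum>e\<in>core_edges. sqrt (\<Prod>v\<in>e. x v))"
  unfolding RRR_def
proof (rule sum.mono_neutral_right)
  show "\<forall>e\<in>E - core_edges. sqrt (\<Prod>v\<in>e. x v) = 0"
  proof
    fix e assume e: "e \<in> E - core_edges"
    then have "e \<subseteq> V" "finite e"
      using simple_graph_finite[OF unicyclic_simple] finite_subset by blast+
    moreover obtain v where "v \<in> e" "v \<notin> core" using e by (auto simp: core_edges_def)
    ultimately have "x v = 0" using degree_leaf[of v] by auto
    then show "sqrt (\<Prod>v\<in>e. x v) = 0"
      using \<open>v \<in> e\<close> \<open>finite e\<close> prod_zero[of e x] by auto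
  qed
qed (use simple_graph_finite(2)[OF unicyclic_simple] core_edges_subset in auto)

lemma x_ge_1: "v \<in> core \<Longrightarrow> 1 \<le> x v"
  by (auto simp: core_def)

section \<open>Cores without leaves, and the graph \<open>Splus_E n\<close>\<close>

text \<open>The vertex \<open>a\<close> uses \<open>n - 1\<close> of the \<open>n\<close> edges, so
  exactly one edge remains, joining two other vertices \<open>b\<close> and \<open>c\<close>.
  Numbering \<open>a\<close>, \<open>b\<close>, \<open>c\<close> first matches
  \<open>Splus_E\<close>.\<close>

lemma graph_iso_Splus_if_dominating:
  assumes a: "a \<in> V" "degree E a = n - 1"
  shows "graph_iso V E (Splus_V n) (Splus_E n)"
proof -
  note fin = simple_graph_finite[OF unicyclic_simple]
  have "{w. {a, w} \<in> E} = V - {a}"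
    using a fin(1) card_V
    by (intro card_subset_eq finite_neighbours(2)[OF unicyclic_simple])
      (auto simp: degree_eq_card_neighbours[OF unicyclic_simple])
  then have adj_a: "{a, w} \<in> E" if "w \<in> V" "w \<noteq> a" for w using that by blast
  have "card (E - {e \<in> E. a \<in> e}) = card E - card {e \<in> E. a \<in> e}"
    using fin(2) by (intro card_Diff_subset) auto
  then have "card (E - {e \<in> E. a \<in> e}) = 1"
    using a(2) card_E n4 by (simp add: degree_def)
  then obtain e where "E - {e \<in> E. a \<in> e} = {e}" by (rule card_1_singletonE)
  then have e: "e \<in> E" "a \<notin> e" by blast+
  from unicyclic_simple e(1) obtain b c where bc: "b \<noteq> c" "b \<in> V" "c \<in> V" "e = {b, c}"
    by (rule simple_graph_edgeE)
  obtain g where g: "bij_betw g {0..<card V} V" "\<And>i. i < length [a, b, c] \<Longrightarrow> g i = [a, b, c] ! i"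
    using exists_bij_with_prefix[of V "[a, b, c]"] fin(1) a bc e by auto
  have g012: "g 0 = a" "g 1 = b" "g 2 = c" using g(2)[of 0] g(2)[of 1] g(2)[of 2] by auto
  show ?thesis
  proof (rule graph_isoI_bij_hom)
    show "bij_betw g (Splus_V n) V" using g(1) card_V by (simp add: Splus_V_def)
    show "Splus_E n \<subseteq> Pow (Splus_V n)"
      by (rule simple_graph_finite(3)[OF simple_graph_Splus[OF n4]])
    show "card (Splus_E n) = card E" using card_Splus_E[OF n4] card_E by simp
    fix d assume "d \<in> Splus_E n"
    then consider k where "d = {0, k}" "k \<in> {1..<n}" | "d = {1, 2}"
      unfolding Splus_E_def by blast
    then show "g ` d \<in> E"
    proof cases
      case (1 k)
      have "g k \<in> V" using bij_betwE[OF g(1)] 1 card_V by auto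
      moreover have "g k \<noteq> a"
        using inj_onD[OF bij_betw_imp_inj_on[OF g(1)], of k 0] 1 g012 card_V by auto
      ultimately show ?thesis using adj_a 1 g012 by simp
    next
      case 2
      then show ?thesis using g012 bc e by simp
    qed
  qed (use fin in auto)
qed

text \<open>Equality forces a core of three vertices, hence a triangle, and makes all products of
  weights vanish. One vertex then carries the whole weight and is adjacent to all others.\<close>

lemma RRR_bound_no_core_leaf:
  assumes deg: "\<And>v. v \<in> core \<Longrightarrow> 2 \<le> degree core_edges v"
  shows "1 + 2 * sqrt (real n - 2) \<le> RRR E"
    and "RRR E = 1 + 2 * sqrt (real n - 2) \<Longrightarrow> graph_iso V E (Splus_V n) (Splus_E n)"
proof -
  note fin = simple_graph_finite[OF core_simple]
  let ?m = "real (card core)"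
  define \<delta> where "\<delta> = sqrt (1 + real n - ?m) - 1"
  obtain \<mu> :: "'a \<Rightarrow> real" where \<mu>: "\<And>v. v \<in> core \<Longrightarrow> 0 \<le> \<mu> v" "(\<Sum>v\<in>core. \<mu> v) = 1"
      "\<And>v. v \<in> core \<Longrightarrow> x v = 1 + \<mu> v * (real n - ?m)"
    and mn: "?m \<le> real n"
    and bound: "?m + 2 * \<delta> + \<delta>\<^sup>2 * (\<Sum>e\<in>core_edges. \<Prod>v\<in>e. \<mu> v) \<le> RRR E"
    unfolding RRR_core
    using edge_sum_bound_min_degree_2[OF core_simple core_card core_nonempty x_ge_1 sum_core deg \<delta>_def]
    by blast
  have prod0: "0 \<le> (\<Prod>v\<in>e. \<mu> v)" if "e \<in> core_edges" for e
    using that fin(3) \<mu>(1) by (intro prod_nonneg) auto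
  then have sum0: "0 \<le> (\<Sum>e\<in>core_edges. \<Prod>v\<in>e. \<mu> v)" by (rule sum_nonneg)
  then have "?m + 2 * \<delta> \<le> RRR E" using bound by (smt (verit) mult_nonneg_nonneg zero_le_power2)
  have m3: "3 \<le> ?m" using core_card_ge_3 by simp
  note mono = sqrt_shift_mono[OF m3 mn, folded \<delta>_def]
  show "1 + 2 * sqrt (real n - 2) \<le> RRR E"
    using mono(1) n4 \<open>?m + 2 * \<delta> \<le> RRR E\<close> by simp
  assume eq: "RRR E = 1 + 2 * sqrt (real n - 2)"
  then have m: "?m = 3" using mono(2) n4 \<open>?m + 2 * \<delta> \<le> RRR E\<close> by fastforce
  then have card3: "card core = 3" by simp
  have "0 < \<delta>" using n4 m by (simp add: \<delta>_def)
  have "\<delta>\<^sup>2 * (\<Sum>e\<in>core_edges. \<Prod>v\<in>e. \<mu> v) \<le> 0"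
    using bound eq m by (simp add: \<delta>_def)
  then have "(\<Sum>e\<in>core_edges. \<Prod>v\<in>e. \<mu> v) = 0"
    using sum0 \<open>0 < \<delta>\<close> by (simp add: mult_le_0_iff)
  then have prod_eq: "(\<Prod>v\<in>e. \<mu> v) = 0" if "e \<in> core_edges" for e
    using that prod0 fin(2) by (simp add: sum_nonneg_eq_0_iff)
  \<comment> \<open>Three edges on three vertices: every pair is an edge, so at most one weight is
    nonzero.\<close>
  have "core_edges = {e. e \<subseteq> core \<and> card e = 2}"
  proof (rule card_subset_eq)
    show "core_edges \<subseteq> {e. e \<subseteq> core \<and> card e = 2}"
      using fin(3) simple_graph_edge_card[OF core_simple] by auto
    show "card core_edges = card {e. e \<subseteq> core \<and> card e = 2}"
      using fin(1) card3 core_card by (simp add: n_subsets choose_two)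
  qed (use fin(1) in simp)
  then have zero: "\<mu> u = 0 \<or> \<mu> w = 0" if "u \<in> core" "w \<in> core" "u \<noteq> w" for u w
    using prod_eq[of "{u, w}"] that by simp
  have "\<exists>a\<in>core. \<mu> a \<noteq> 0"
  proof (rule ccontr)
    assume "\<not> ?thesis"
    then have "(\<Sum>v\<in>core. \<mu> v) = 0" by simp
    then show False using \<mu>(2) by simp
  qed
  then obtain a where a: "a \<in> core" "\<mu> a \<noteq> 0" by blast
  have "(\<Sum>v\<in>core. \<mu> v) = (\<Sum>v\<in>{a}. \<mu> v)"
    using fin(1) a zero by (intro sum.mono_neutral_right) auto
  then have "\<mu> a = 1" using \<mu>(2) by simp
  then have "degree E a = n - 1" using \<mu>(3)[OF a(1)] m n4 by simp
  then show "graph_iso V E (Splus_V n) (Splus_E n)"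
    using graph_iso_Splus_if_dominating a(1) core_subset by blast
qed

section \<open>Cores with a leaf, and the graph \<open>H_E n\<close>\<close>

text \<open>Four of the five core edges join \<open>y\<close> to \<open>Y = {a, b, w}\<close> and
  \<open>v\<close> to \<open>w\<close>. The core edges at \<open>y\<close> and \<open>v\<close> are
  then exhausted and \<open>w\<close> has degree 2, so the fifth edge is \<open>{a, b}\<close>. The
  degree of \<open>v\<close> makes it the neighbour of every leaf.\<close>

lemma graph_iso_H_if_core:
  assumes yv: "y \<in> core" "v \<in> core" "v \<noteq> y" and card5: "card core = 5" and n7: "7 \<le> n"
    and Y: "Y = {w. {y, w} \<in> core_edges}" "card Y = 3" "v \<notin> Y"
    and deg_v: "degree core_edges v = 1" "degree E v = n - 4"
    and deg_Y: "\<And>w. w \<in> Y \<Longrightarrow> degree E w = 2"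
  shows "graph_iso V E (H_V n) (H_E n)"
proof -
  note fin = simple_graph_finite[OF unicyclic_simple]
  note fin' = simple_graph_finite[OF core_simple]
  have finY: "finite Y" and YC: "Y \<subseteq> core - {y}"
    using finite_neighbours[OF core_simple] Y(1) by auto
  have core_eq: "core = insert y (insert v Y)"
  proof (rule card_subset_eq[symmetric])
    show "insert y (insert v Y) \<subseteq> core" using YC yv by blast
    show "card (insert y (insert v Y)) = card core"
      using finY YC yv Y(2,3) card5 by (auto simp: card_insert_if)
  qed (rule fin'(1))
  have "card {w. {v, w} \<in> core_edges} = 1"
    using deg_v by (simp add: degree_eq_card_neighbours[OF core_simple])
  then obtain w where w: "{w. {v, w} \<in> core_edges} = {w}" by (rule card_1_singletonE)
  then have vw: "{v, w} \<in> core_edges" by blast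
  have "y \<notin> {w. {v, w} \<in> core_edges}" using Y(1,3) by (simp add: insert_commute)
  then have "y \<noteq> w" unfolding w by simp
  then have wY: "w \<in> Y"
    using core_eq simple_graph_edgeD(1,3)[OF core_simple vw] by simp
  have "card (Y - {w}) = 2" using Y(2) wY finY by simp
  then obtain a b where ab: "Y - {w} = {a, b}" "a \<noteq> b" by (auto simp: card_2_iff)
  have inY: "a \<in> Y" "b \<in> Y" "a \<noteq> w" "b \<noteq> w" using ab by blast+
  then have yabw: "{y, a} \<in> core_edges" "{y, b} \<in> core_edges" "{y, w} \<in> core_edges" using Y(1) wY by auto
  have ne: "y \<noteq> w" "y \<noteq> a" "y \<noteq> b" "v \<noteq> w" "v \<noteq> a" "v \<noteq> b" using YC Y(3) inY wY by auto
  let ?A = "{{y, a}, {y, b}, {y, w}, {v, w}}"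
  have "card ?A \<le> 4" by (simp add: card_insert_if)
  moreover have "?A \<subseteq> core_edges" using yabw vw by blast
  moreover have "card core_edges = 5" using card5 core_card by simp
  ultimately obtain e where e: "e \<in> core_edges" "e \<notin> ?A"
    using card_mono[of ?A core_edges] by fastforce
  from core_simple e(1) obtain p q where pq: "p \<noteq> q" "p \<in> core" "q \<in> core" "e = {p, q}"
    by (rule simple_graph_edgeE)
  have core_abw: "core = {y, v, a, b, w}" using core_eq ab wY by blast
  have "y \<notin> e"
  proof
    assume "y \<in> e"
    then obtain q' where q': "e = {y, q'}" using pq by (auto simp: insert_commute)
    then have "q' \<in> Y" using e Y(1) by simp
    then have "q' = a \<or> q' = b \<or> q' = w" using ab by blast
    then show False using e(2) q' by blast
  qed
  moreover have "v \<notin> e"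
  proof
    assume "v \<in> e"
    then obtain q' where q': "e = {v, q'}" using pq by (auto simp: insert_commute)
    then have "q' \<in> {w. {v, w} \<in> core_edges}" using e by simp
    then have "q' = w" unfolding w by simp
    then show False using e(2) q' by blast
  qed
  moreover have "w \<notin> e"
  proof
    assume "w \<in> e"
    have sub: "{{y, w}, {v, w}, e} \<subseteq> {e \<in> E. w \<in> e}"
      using yabw vw e(1) core_edges_subset \<open>w \<in> e\<close> by auto
    have "e \<noteq> {y, w}" "e \<noteq> {v, w}" using e(2) by blast+
    then have "card {{y, w}, {v, w}, e} = 3"
      using yv(3) by (auto simp: card_insert_if doubleton_eq_iff)
    then have "3 \<le> degree E w"
      unfolding degree_def using card_mono[OF _ sub] fin(2) by simp
    then show False using deg_Y[OF wY] by simp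
  qed
  ultimately have "e = {a, b}" using pq core_abw by auto
  then have edges: "{y, a} \<in> E" "{y, b} \<in> E" "{a, b} \<in> E" "{y, w} \<in> E" "{w, v} \<in> E"
    using yabw vw e(1) core_edges_subset by (auto simp: insert_commute)
  have "{k. {v, k} \<in> E} \<subseteq> insert w (V - core)"
  proof
    fix k assume "k \<in> {k. {v, k} \<in> E}"
    then have k: "{v, k} \<in> E" by simp
    show "k \<in> insert w (V - core)"
    proof (cases "k \<in> core")
      case True
      then have "k \<in> {w. {v, w} \<in> core_edges}" using k yv by (simp add: core_edges_def)
      then show ?thesis unfolding w by simp
    next
      case False
      then show ?thesis using simple_graph_edgeD(3)[OF unicyclic_simple k] by simp
    qed
  qed
  \<comment> \<open>The count is \<open>w\<close> together with the \<open>n - 5\<close> leaves; it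
    agrees with the degree of \<open>v\<close>, so the inclusion is an equality.\<close>
  moreover have "card (insert w (V - core)) = n - 4"
    using card_Diff_subset[OF fin'(1) core_subset] card5 card_V n7 fin(1) core_abw by simp
  ultimately have "{k. {v, k} \<in> E} = insert w (V - core)"
    using fin(1) deg_v(2)
    by (intro card_subset_eq) (auto simp: degree_eq_card_neighbours[OF unicyclic_simple])
  then have leaf: "{v, k} \<in> E" if "k \<in> V - core" for k using that by blast
  \<comment> \<open>The order follows the labels 0 to 4 in \<open>H_E\<close>.\<close>
  let ?vs = "[y, a, b, w, v]"
  have "set ?vs = core" using core_abw by auto
  moreover have "distinct ?vs" using ne ab(2) inY yv by auto
  ultimately obtain g where g: "bij_betw g {0..<card V} V" "\<And>i. i < length ?vs \<Longrightarrow> g i = ?vs ! i"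
    using exists_bij_with_prefix[of V ?vs] fin(1) core_subset by blast
  have g0: "g 0 = y" "g 1 = a" "g 2 = b" "g 3 = w" "g 4 = v"
    using g(2)[of 0] g(2)[of 1] g(2)[of 2] g(2)[of 3] g(2)[of 4] by (auto simp: numeral_eq_Suc)
  show ?thesis
  proof (rule graph_isoI_bij_hom)
    show "bij_betw g (H_V n) V" using g(1) card_V by (simp add: H_V_def)
    show "H_E n \<subseteq> Pow (H_V n)"
      using n7 by (intro simple_graph_finite(3)[OF simple_graph_H]) simp
    show "card (H_E n) = card E" using card_H_E n7 card_E by simp
    fix d assume "d \<in> H_E n"
    then consider "d = {0, 1}" | "d = {0, 2}" | "d = {1, 2}" | "d = {0, 3}" | "d = {3, 4}"
      | k where "d = {4, k}" "k \<in> {5..<n}"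
      unfolding H_E_def by blast
    then show "g ` d \<in> E"
    proof cases
      case (6 k)
      have "g k \<in> V" using bij_betwE[OF g(1)] 6 card_V by auto
      moreover have "g k \<noteq> g i" if "i < 5" for i
        using inj_onD[OF bij_betw_imp_inj_on[OF g(1)], of k i] 6 card_V that by auto
      from this[of 0] this[of 1] this[of 2] this[of 3] this[of 4]
      have "g k \<notin> core" using g0 core_abw by simp
      ultimately show ?thesis using leaf 6 g0 by simp
    qed (use g0 edges in simp_all)
  qed (use fin in auto)
qed

text \<open>The average core degree is exactly 2, since the core has as many edges as vertices; a
  vertex below the average forces one above it.\<close>

lemma exists_core_branch_vertex:
  assumes "v \<in> core" "degree core_edges v < 2"
  shows "\<exists>y\<in>core. 3 \<le> degree core_edges y"
proof (rule ccontr)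
  assume "\<not> ?thesis"
  then have "degree core_edges u \<le> 2" if "u \<in> core" for u using that by force
  then have "(\<Sum>u\<in>core. degree core_edges u) < (\<Sum>u\<in>core. 2)"
    using assms simple_graph_finite(1)[OF core_simple] by (intro sum_strict_mono_ex1) auto
  then show False using handshake[OF core_simple] core_card by simp
qed

text \<open>Three edges at a branch vertex \<open>y\<close> gain \<open>sqrt 2 - 1\<close> each, and
  the weights contribute at least \<open>\<delta>\<close> in total. In a core of size 4 every vertex
  other than \<open>y\<close> is a neighbour of \<open>y\<close>, which raises this to
  \<open>sqrt 2 * \<delta>\<close>. In the equality case all weight sits on the one core vertex
  outside \<open>y\<close> and its neighbours.\<close>

lemma RRR_bound_core_leaf:
  assumes v: "v \<in> core" "degree core_edges v < 2"
  shows "card core = 4 \<Longrightarrow> 5 \<le> n \<and> 1 + 2 * sqrt 2 + sqrt 2 * sqrt (real n - 4) \<le> RRR E"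
    and "card core \<noteq> 4 \<Longrightarrow> 6 \<le> n \<and> 1 + 3 * sqrt 2 + sqrt (real n - 5) \<le> RRR E"
    and "card core \<noteq> 4 \<Longrightarrow> 7 \<le> n \<Longrightarrow> RRR E = 1 + 3 * sqrt 2 + sqrt (real n - 5) \<Longrightarrow>
      graph_iso V E (H_V n) (H_E n)"
proof -
  note fin = simple_graph_finite[OF core_simple]
  let ?m = "real (card core)"
  let ?d = "degree core_edges"
  obtain y where y: "y \<in> core" "3 \<le> ?d y" using exists_core_branch_vertex[OF v] by blast
  have xy: "2 \<le> x y" using core_degree_le[OF y(1)] y(2) by simp
  define \<delta> where "\<delta> = sqrt (real n - ?m) - 1"
  define \<epsilon> where "\<epsilon> = sqrt (real n - ?m + 1) - sqrt 2"
  define Y where "Y = {w. {y, w} \<in> core_edges}"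
  have finY: "finite Y" and YC: "Y \<subseteq> core - {y}"
    using finite_neighbours[OF core_simple] Y_def by auto
  have card_Y: "card Y = ?d y" by (simp add: Y_def degree_eq_card_neighbours[OF core_simple])
  have card_Cy: "card (core - {y}) = card core - 1" using fin(1) y by simp
  have m4: "4 \<le> card core" using card_mono[OF _ YC] card_Cy card_Y y(2) fin(1) by simp
  obtain \<mu> :: "'a \<Rightarrow> real" where \<mu>: "\<And>v. v \<in> core \<Longrightarrow> 0 \<le> \<mu> v" "(\<Sum>v\<in>core. \<mu> v) = 1"
      "\<And>v. v \<in> core \<Longrightarrow> x v = (if v = y then 2 else 1) + \<mu> v * (real n - ?m - 1)"
    and mn: "?m + 1 \<le> real n"
    and bound: "?m + (\<Sum>v\<in>core. ?d v * (\<mu> v * (if v = y then \<epsilon> else \<delta>)))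
       + (sqrt 2 - 1) * (?d y + (\<Sum>w\<in>Y. \<mu> w * \<delta>)) \<le> RRR E"
    unfolding RRR_core Y_def
    using edge_sum_bound_branch_vertex[OF core_simple core_card x_ge_1 sum_core y(1) xy \<delta>_def \<epsilon>_def]
    by blast
  define g where "g v = ?d v * (\<mu> v * (if v = y then \<epsilon> else \<delta>))" for v
  have \<delta>0: "0 \<le> \<delta>" using mn by (simp add: \<delta>_def)
  \<comment> \<open>Since \<open>y\<close> has core degree at least 3, weight on \<open>y\<close>
    counts at least \<open>3 * \<epsilon>\<close> per unit; by this estimate that is no less than
    \<open>sqrt 2 * \<delta>\<close>.\<close>
  have \<epsilon>: "sqrt 2 * \<delta> \<le> 3 * \<epsilon>"
  proof -
    have "(sqrt (real n - ?m))\<^sup>2 = real n - ?m" using mn by simp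
    then have "\<delta> / sqrt 2 \<le> \<epsilon>"
      using sqrt_increment_compare[of "sqrt (real n - ?m)"] mn by (simp add: \<delta>_def \<epsilon>_def)
    moreover have "sqrt 2 * \<delta> = 2 * (\<delta> / sqrt 2)" by (simp add: field_simps)
    moreover have "0 \<le> \<delta> / sqrt 2" using \<delta>0 by simp
    ultimately show ?thesis by linarith
  qed
  have \<delta>_le: "\<delta> \<le> sqrt 2 * \<delta>" using \<delta>0 sqrt_2_bounds mult_right_mono[of 1 "sqrt 2" \<delta>] by simp
  have gy: "\<mu> y * (sqrt 2 * \<delta>) \<le> g y"
  proof -
    have "0 \<le> \<epsilon>" using \<epsilon> \<delta>_le \<delta>0 by simp
    then have "sqrt 2 * \<delta> \<le> ?d y * \<epsilon>" using \<epsilon> y(2) mult_right_mono[of 3 "real (?d y)" \<epsilon>] by simp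
    then show ?thesis using \<mu>(1)[OF y(1)] mult_left_mono[of _ _ "\<mu> y"] by (fastforce simp: g_def algebra_simps)
  qed
  have g_ge: "\<mu> v * \<delta> \<le> g v" if "v \<in> core" for v
  proof (cases "v = y")
    case True
    then show ?thesis using gy \<delta>_le mult_left_mono[OF \<delta>_le \<mu>(1)[OF y(1)]] by simp
  next
    case False
    have "1 * (\<mu> v * \<delta>) \<le> ?d v * (\<mu> v * \<delta>)"
      using core_degree_ge_1[OF that] \<mu>(1)[OF that] \<delta>0 by (intro mult_right_mono) auto
    then show ?thesis using False by (simp add: g_def)
  qed
  have sum_\<mu>: "(\<Sum>v\<in>core. \<mu> v * c) = c" for c
    using \<mu>(2) by (simp add: sum_distrib_right[symmetric])
  have sum_g: "\<delta> \<le> (\<Sum>v\<in>core. g v)"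
    using sum_mono[of core "\<lambda>v. \<mu> v * \<delta>" g] g_ge sum_\<mu>[of \<delta>] by simp
  have Y0: "0 \<le> \<mu> w * \<delta>" if "w \<in> Y" for w using that YC \<mu>(1) \<delta>0 by auto
  then have sum_Y: "0 \<le> (\<Sum>w\<in>Y. \<mu> w * \<delta>)" by (rule sum_nonneg)
  have d3: "3 \<le> real (?d y)" using y(2) by simp
  \<comment> \<open>\<open>P\<close> is the gain from core edges at \<open>y\<close> beyond three,
    \<open>Q\<close> the gain from weight on neighbours of \<open>y\<close>. Both must vanish in the
    equality case.\<close>
  define P Q where "P = (sqrt 2 - 1) * (real (?d y) - 3)" and "Q = (sqrt 2 - 1) * (\<Sum>w\<in>Y. \<mu> w * \<delta>)"
  have "(sqrt 2 - 1) * (?d y + (\<Sum>w\<in>Y. \<mu> w * \<delta>)) = 3 * (sqrt 2 - 1) + P + Q"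
    by (simp add: P_def Q_def algebra_simps)
  then have bound': "?m + (\<Sum>v\<in>core. g v) + 3 * (sqrt 2 - 1) + P + Q \<le> RRR E"
    using bound[folded g_def] by simp
  have pos: "0 \<le> P" "0 \<le> Q" using d3 sum_Y by (simp_all add: P_def Q_def)

  show "5 \<le> n \<and> 1 + 2 * sqrt 2 + sqrt 2 * sqrt (real n - 4) \<le> RRR E" if m: "card core = 4"
  proof
    show "5 \<le> n" using mn m by simp
    \<comment> \<open>At least three neighbours of \<open>y\<close> lie among the three other core
      vertices.\<close>
    have Y_eq: "Y = core - {y}"
      using fin(1) YC card_Y card_Cy y(2) m card_mono[OF _ YC] by (intro card_subset_eq) auto
    have "sqrt 2 * \<delta> = (\<Sum>v\<in>core. \<mu> v * (sqrt 2 * \<delta>))" by (rule sum_\<mu>[symmetric])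
    also have "\<dots> = \<mu> y * (sqrt 2 * \<delta>) + (\<Sum>w\<in>Y. \<mu> w * (sqrt 2 * \<delta>))"
      unfolding Y_eq by (rule sum.remove[OF fin(1) y(1)])
    also have "\<dots> \<le> g y + (\<Sum>w\<in>Y. g w + (sqrt 2 - 1) * (\<mu> w * \<delta>))"
    proof (intro add_mono gy sum_mono)
      fix w assume "w \<in> Y"
      then show "\<mu> w * (sqrt 2 * \<delta>) \<le> g w + (sqrt 2 - 1) * (\<mu> w * \<delta>)"
        using g_ge[of w] YC by (auto simp: algebra_simps)
    qed
    also have "\<dots> = (\<Sum>v\<in>core. g v) + (sqrt 2 - 1) * (\<Sum>w\<in>Y. \<mu> w * \<delta>)"
      using sum.remove[OF fin(1) y(1), of g] Y_eq by (simp add: sum.distrib sum_distrib_left)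
    finally have "4 + 3 * (sqrt 2 - 1) + sqrt 2 * \<delta> \<le> RRR E"
      using bound' pos(1) m by (simp add: Q_def)
    then show "1 + 2 * sqrt 2 + sqrt 2 * sqrt (real n - 4) \<le> RRR E"
      using m by (simp add: \<delta>_def algebra_simps)
  qed

  assume "card core \<noteq> 4"
  then have m5: "5 \<le> ?m" using m4 by simp
  have mn': "?m \<le> real n - 1" using mn by simp
  note mono = sqrt_shift_mono1[OF m5 mn']
  show "6 \<le> n \<and> 1 + 3 * sqrt 2 + sqrt (real n - 5) \<le> RRR E"
    using bound' pos sum_g mono(1) m5 mn by (simp add: \<delta>_def)

  assume n7: "7 \<le> n" and eq: "RRR E = 1 + 3 * sqrt 2 + sqrt (real n - 5)"
  have m: "?m = 5"
    using bound' pos sum_g mono(2) eq by (fastforce simp: \<delta>_def)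
  have \<delta>_m: "\<delta> = sqrt (real n - 5) - 1" unfolding \<delta>_def m ..
  \<comment> \<open>With \<open>n = 6\<close> there would be no excess and
    \<open>\<delta> = 0\<close>; from \<open>n = 7\<close> on, vanishing multiples of
    \<open>\<delta>\<close> give vanishing weights.\<close>
  have \<delta>1: "0 < \<delta>" using n7 m by (simp add: \<delta>_def)
  have "((\<Sum>v\<in>core. g v) - \<delta>) + P + Q \<le> 0" using bound'[unfolded m eq] \<delta>_m by simp
  then have eqs: "(\<Sum>v\<in>core. g v) = \<delta>" "P = 0" "Q = 0"
    using pos sum_g by simp_all
  have dy: "?d y = 3" using eqs(2) by (simp add: P_def)
  have "(\<Sum>w\<in>Y. \<mu> w * \<delta>) = 0" using eqs(3) by (simp add: Q_def)
  then have \<mu>Y: "\<mu> w = 0" if "w \<in> Y" for w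
    using that Y0 finY \<delta>1 by (simp add: sum_nonneg_eq_0_iff)
  have "(\<Sum>v\<in>core. g v - \<mu> v * \<delta>) = 0" using eqs(1) sum_\<mu>[of \<delta>] by (simp add: sum_subtractf)
  then have g_eq: "g v = \<mu> v * \<delta>" if "v \<in> core" for v
    using that g_ge fin(1) by (simp add: sum_nonneg_eq_0_iff)
  have \<mu>y: "\<mu> y = 0"
  proof (rule ccontr)
    assume "\<mu> y \<noteq> 0"
    then have "0 < \<mu> y" using \<mu>(1)[OF y(1)] by simp
    \<comment> \<open>Weight on \<open>y\<close> would count at least
      \<open>sqrt 2 * \<delta>\<close> per unit, but equality permits only
      \<open>\<delta>\<close>.\<close>
    moreover have "\<delta> < sqrt 2 * \<delta>" using \<delta>1 by simp
    ultimately have "\<mu> y * \<delta> < \<mu> y * (sqrt 2 * \<delta>)" by (rule mult_strict_left_mono[rotated])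
    then show False using gy g_eq[OF y(1)] by simp
  qed
  have "card (core - {y} - Y) = 1"
    using card_Diff_subset[OF finY YC] card_Cy card_Y dy m by simp
  then obtain z where z: "core - {y} - Y = {z}" by (rule card_1_singletonE)
  then have z': "z \<in> core" "z \<noteq> y" "z \<notin> Y" by blast+
  have "(\<Sum>v\<in>core. \<mu> v) = (\<Sum>v\<in>{z}. \<mu> v)"
    using fin(1) z z' \<mu>Y \<mu>y by (intro sum.mono_neutral_right) blast+
  then have \<mu>z: "\<mu> z = 1" using \<mu>(2) by simp
  show "graph_iso V E (H_V n) (H_E n)"
  proof (rule graph_iso_H_if_core[OF y(1) z'(1,2) _ n7 Y_def _ z'(3)])
    show "card core = 5" using m by simp
    show "card Y = 3" using card_Y dy by simp
    show "?d z = 1" using g_eq[OF z'(1)] z'(2) \<mu>z \<delta>1 by (simp add: g_def)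
    \<comment> \<open>All the excess is on \<open>z\<close>, so
      \<open>x z = 1 + (n - 5 - 1)\<close>.\<close>
    show "degree E z = n - 4" using \<mu>(3)[OF z'(1)] z'(2) \<mu>z m n7 by simp
    show "degree E w = 2" if "w \<in> Y" for w
    proof -
      have "w \<in> core" "w \<noteq> y" using that YC by auto
      then show ?thesis using \<mu>(3)[of w] \<mu>Y[OF that] by simp
    qed
  qed
qed

end

theorem theorem1:
  fixes V :: "'a set" and E :: "'a set set" and n :: nat
  assumes "unicyclic V E" and "card V = n" and "4 \<le> n"
  shows "(n \<le> 16 \<longrightarrow>
            RRR E \<ge> 1 + 2 * sqrt (real n - 2) \<and>
            (RRR E = 1 + 2 * sqrt (real n - 2) \<longleftrightarrow> graph_iso V E (Splus_V n) (Splus_E n)))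
       \<and> (17 \<le> n \<longrightarrow>
            RRR E \<ge> 1 + 3 * sqrt 2 + sqrt (real n - 5) \<and>
            (RRR E = 1 + 3 * sqrt 2 + sqrt (real n - 5) \<longleftrightarrow> graph_iso V E (H_V n) (H_E n)))"
proof -
  interpret unicyclic_graph V E n using assms by unfold_locales
  have iso_S: "RRR E = 1 + 2 * sqrt (real n - 2)" if "graph_iso V E (Splus_V n) (Splus_E n)"
    using RRR_graph_iso[OF that unicyclic_simple simple_graph_Splus[OF n4]] RRR_Splus[OF n4] by simp
  have iso_H: "RRR E = 1 + 3 * sqrt 2 + sqrt (real n - 5)" if "graph_iso V E (H_V n) (H_E n)" "17 \<le> n"
    using RRR_graph_iso[OF that(1) unicyclic_simple simple_graph_H] RRR_H[of n] that(2) by simp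
  show ?thesis
  \<comment> \<open>The three cases have three lower bounds. In each range of \<open>n\<close> the
    claimed value is strictly below the bounds of the other two cases, so equality can occur in only
    one of them. Where a core leaf exists, the lower bounds on \<open>n\<close> needed for the
    comparisons come from \<open>RRR_bound_core_leaf\<close>.\<close>
  proof (cases "\<forall>v\<in>core. 2 \<le> degree core_edges v")
    case True
    then show ?thesis
      using RRR_bound_no_core_leaf iso_S iso_H H_value_less_Splus_value[of "real n"] by fastforce
  next
    case False
    then obtain v where v: "v \<in> core" "degree core_edges v < 2" by auto
    note B = RRR_bound_core_leaf[OF v]
    show ?thesis
    proof (cases "card core = 4")
      case True
      then show ?thesis
        using B(1) iso_S iso_H H_value_less_paw_value[of "real n"] Splus_value_less_paw_value[of "real n"]
        by fastforce
    next
      case False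
      then show ?thesis
        using B(2,3) iso_S iso_H Splus_value_less_H_value[of "real n"] by fastforce
    qed
  qed
qed

end
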